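(* Let $\theta=\{\theta_k\}_{k\in\mathbb Z}$ belong to $\mathcal S(p,\omega)$ for some $p\in\mathbb N$ and $\omega>0$, and suppose that $\psi\in\mathcal{BPC}(\theta)$ is an unpredictable function (with values in $\mathbb R^m$) such that $\sup_{t\in\mathbb R}\|\psi(t)\|\le H$ for some $H>0$. If $\xi\in\mathcal{BPC}(\theta)$ is a function with $\|\xi(t)\|\to0$ as $t\to\infty$ such that either $\|\xi(t_0)\|\ge 4H$ for some $t_0\in\mathbb R$ or $\|\xi(\theta_{k_0}+)\|>4H$ for some $k_0\in\mathbb Z$, then the asymptotically unpredictable function $\phi\in\mathcal{BPC}(\theta)$ satisfying $\phi(t)=\psi(t)+\xi(t)$, $t\in\mathbb R$, is not unpredictable.
   Context: Vectors carry the Euclidean norm. $\mathcal S(p,\omega)$ is the set of strictly increasing real sequences $\theta=\{\theta_k\}_{k\in\mathbb Z}$ with $\theta_{k+p}=\theta_k+\omega$ for all $k\in\mathbb Z$ ($p\in\mathbb N$, $\omega>0$). $\mathcal{BPC}(\theta)$ is the set of bounded functions $\varphi:\mathbb R\to\mathbb R^m$ such that for each $k\in\mathbb Z$: $\varphi$ is continuous on $(\theta_{k-1},\theta_k)$, the right limit $\varphi(\theta_k+)=\lim_{t\to\theta_k^+}\varphi(t)$ exists, and $\varphi(\theta_k)=\lim_{t\to\theta_k^-}\varphi(t)$. For a piecewise continuous $\varphi$, $\varphi(s+)$ denotes its right limit at $s$. Unpredictable function: $\psi\in\mathcal{BPC}(\theta)$, with $\theta\in\mathcal S(p,\omega)$,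 is unpredictable if there exist positive numbers $\varepsilon_0,\nu$ and real sequences $\{\mu_n\}_{n\in\mathbb N}$, $\{\tau_n\}_{n\in\mathbb N}$, both diverging to infinity, such that (i) for every $\varepsilon>0$ there is $\delta>0$ with $\|\psi(s_1)-\psi(s_2)\|<\varepsilon$ whenever $s_1,s_2$ belong to the same interval of continuity (one of the intervals determined by consecutive $\theta_{k-1},\theta_k$) and $|s_1-s_2|<\delta$; (ii) $\|\psi(t+\mu_n)-\psi(t)\|\to0$ as $n\to\infty$ uniformly on compact subsets of $\mathbb R$; (iii) $\|\psi(t+\mu_n)-\psi(t)\|\ge\varepsilon_0$ for each $t\in[\tau_n-\nu,\tau_n+\nu]$ and $n\in\mathbb N$. Asymptotically unpredictable function: $\phi\in\mathcal{BPC}(\theta)$, with $\theta\in\mathcal S(p,\omega)$, is asymptotically unpredictable if $\phi(t)=\psi(t)+\xi(t)$ for all $t\in\mathbb R$, for some unpredictable $\psi\in\mathcal{BPC}(\theta)$ and some $\xi\in\mathcal{BPC}(\theta)$ with $\|\xi(t)\|\to0$ as $t\to\infty$. *)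

theory Defs
  imports "HOL-Analysis.Analysis"
begin

text \<open>
  The case \<open>p = 0\<close> need not be excluded: the set is then empty for every \<open>\<omega> > 0\<close>.
\<close>

definition S_seq :: "nat \<Rightarrow> real \<Rightarrow> (int \<Rightarrow> real) set" where
  "S_seq p \<omega> = {\<theta>. strict_mono \<theta> \<and> (\<forall>k. \<theta> (k + int p) = \<theta> k + \<omega>)}"

definition BPC :: "(int \<Rightarrow> real) \<Rightarrow> (real \<Rightarrow> real ^ 'm) set" where
  "BPC \<theta> = {\<phi>. bounded (range \<phi>) \<and>
     (\<forall>k. continuous_on {\<theta> (k - 1)<..<\<theta> k} \<phi> \<and>
          (\<exists>l. (\<phi> \<longlongrightarrow> l) (at_right (\<theta> k))) \<and>
          (\<phi> \<longlongrightarrow> \<phi> (\<theta> k)) (at_left (\<theta> k)))}"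

text \<open>\<open>right_limit \<phi> s\<close> is \<open>\<phi>(s+)\<close>; it is meaningful only where that limit exists.\<close>

definition right_limit :: "(real \<Rightarrow> real ^ 'm) \<Rightarrow> real \<Rightarrow> real ^ 'm" where
  "right_limit \<phi> s = Lim (at_right s) \<phi>"

text \<open>
  Elements of \<open>BPC \<theta>\<close> are left-continuous at every \<open>\<theta> k\<close>, so their intervals of continuity
  are the half-open intervals \<open>{\<theta> (k - 1)<..\<theta> k}\<close>. The sequences \<open>\<mu>\<close> and \<open>\<tau>\<close> diverge to
  \<open>+\<infinity>\<close>.
\<close>

definition unpredictable :: "(int \<Rightarrow> real) \<Rightarrow> (real \<Rightarrow> real ^ 'm) \<Rightarrow> bool" where
  "unpredictable \<theta> \<psi> \<longleftrightarrow>
     (\<exists>p \<omega>. \<omega> > 0 \<and> \<theta> \<in> S_seq p \<omega>) \<and> \<psi> \<in> BPC \<theta> \<and>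
     (\<exists>\<epsilon>\<^sub>0 > 0. \<exists>\<nu> > 0. \<exists>\<mu> \<tau> :: nat \<Rightarrow> real.
        filterlim \<mu> at_top sequentially \<and> filterlim \<tau> at_top sequentially \<and>
        (\<forall>\<epsilon> > 0. \<exists>\<delta> > 0. \<forall>k. \<forall>s\<^sub>1 \<in> {\<theta> (k - 1)<..\<theta> k}. \<forall>s\<^sub>2 \<in> {\<theta> (k - 1)<..\<theta> k}.
           \<bar>s\<^sub>1 - s\<^sub>2\<bar> < \<delta> \<longrightarrow> norm (\<psi> s\<^sub>1 - \<psi> s\<^sub>2) < \<epsilon>) \<and>
        (\<forall>K. compact K \<longrightarrow>
           uniform_limit K (\<lambda>n t. norm (\<psi> (t + \<mu> n) - \<psi> t)) (\<lambda>_. 0) sequentially) \<and>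
        (\<forall>n. \<forall>t \<in> {\<tau> n - \<nu>..\<tau> n + \<nu>}. norm (\<psi> (t + \<mu> n) - \<psi> t) \<ge> \<epsilon>\<^sub>0))"

definition asymptotically_unpredictable ::
    "(int \<Rightarrow> real) \<Rightarrow> (real \<Rightarrow> real ^ 'm) \<Rightarrow> bool" where
  "asymptotically_unpredictable \<theta> \<phi> \<longleftrightarrow>
     (\<exists>p \<omega>. \<omega> > 0 \<and> \<theta> \<in> S_seq p \<omega>) \<and> \<phi> \<in> BPC \<theta> \<and>
     (\<exists>\<psi> \<xi>. unpredictable \<theta> \<psi> \<and> \<xi> \<in> BPC \<theta> \<and>
        ((\<lambda>t. norm (\<xi> t)) \<longlongrightarrow> 0) at_top \<and> (\<forall>t. \<phi> t = \<psi> t + \<xi> t))"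

end

theory Submission imports Defs begin

text \<open>
  If \<open>\<phi> = \<psi> + \<xi>\<close> were unpredictable, then \<open>\<phi> t = lim \<phi> (t + \<mu> n)\<close> for every \<open>t\<close>. Since
  \<open>\<xi>\<close> vanishes at infinity, this limit has norm at most \<open>sup \<parallel>\<psi>\<parallel> \<le> H\<close>, whence \<open>\<parallel>\<xi> t\<parallel> \<le> 2 H\<close>
  everywhere. A right limit of norm greater than \<open>4 H\<close> is no different from a value of that size,
  because such values are then attained to the right of the point.
\<close>

lemma BPC_add:
  fixes f g :: "real \<Rightarrow> real ^ 'm"
  assumes f: "f \<in> BPC \<theta>" and g: "g \<in> BPC \<theta>"
  shows "(\<lambda>t. f t + g t) \<in> BPC \<theta>"
proof -
  have "bounded (range (\<lambda>t. f t + g t))"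
    using f g by (intro bounded_plus_comp) (simp_all add: BPC_def)
  moreover have "continuous_on {\<theta> (k - 1)<..<\<theta> k} (\<lambda>t. f t + g t)"
    and "((\<lambda>t. f t + g t) \<longlongrightarrow> f (\<theta> k) + g (\<theta> k)) (at_left (\<theta> k))" for k
    using f g by (auto simp: BPC_def intro: continuous_on_add tendsto_add)
  moreover have "\<exists>l. ((\<lambda>t. f t + g t) \<longlongrightarrow> l) (at_right (\<theta> k))" for k
  proof -
    obtain a b where "(f \<longlongrightarrow> a) (at_right (\<theta> k))" "(g \<longlongrightarrow> b) (at_right (\<theta> k))"
      using f g unfolding BPC_def by blast
    then show ?thesis
      using tendsto_add by blast
  qed
  ultimately show ?thesis
    by (auto simp: BPC_def)
qed

text \<open>\<open>right_limit\<close> is a \<open>Lim\<close>, which says something only once a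
  limit is known to exist; membership in \<open>BPC \<theta>\<close> supplies one, and limits along
  \<open>at_right\<close> are unique.\<close>

lemma BPC_tendsto_right_limit:
  assumes "f \<in> BPC \<theta>"
  shows "(f \<longlongrightarrow> right_limit f (\<theta> k)) (at_right (\<theta> k))"
proof -
  obtain l where l: "(f \<longlongrightarrow> l) (at_right (\<theta> k))"
    using assms by (auto simp: BPC_def)
  then have "right_limit f (\<theta> k) = l"
    unfolding right_limit_def by (intro tendsto_Lim) auto
  with l show ?thesis
    by simp
qed

text \<open>Uniform convergence on compact sets, applied to the singleton \<open>{t}\<close>, gives
  pointwise recurrence along one sequence \<mu> that serves every t.\<close>

lemma unpredictable_recurrence:
  assumes "unpredictable \<theta> f"
  obtains \<mu> :: "nat \<Rightarrow> real" where "filterlim \<mu> at_top sequentially"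
    and "\<And>t. (\<lambda>n. f (t + \<mu> n)) \<longlonglongrightarrow> f t"
proof -
  obtain \<mu> :: "nat \<Rightarrow> real" where \<mu>: "filterlim \<mu> at_top sequentially"
    and unif: "\<forall>K. compact K \<longrightarrow>
      uniform_limit K (\<lambda>n t. norm (f (t + \<mu> n) - f t)) (\<lambda>_. 0) sequentially"
    using assms unfolding unpredictable_def by (elim conjE exE) (rule that)
  have "(\<lambda>n. f (t + \<mu> n)) \<longlonglongrightarrow> f t" for t
  proof -
    have "(\<lambda>n. norm (f (t + \<mu> n) - f t)) \<longlonglongrightarrow> 0"
      using tendsto_uniform_limitI[OF unif[rule_format, of "{t}"], of t] by simp
    then show ?thesis
      by (simp add: tendsto_norm_zero_iff LIM_zero_iff)
  qed
  with \<mu> show ?thesis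
    by (rule that)
qed

text \<open>Recurrence carries a bound valid asymptotically at infinity back to every point:
  \<open>norm (f (t + \<mu> n))\<close> is at most H plus a term tending to 0, and its limit is
  \<open>norm (f t)\<close>.\<close>

lemma unpredictable_norm_le:
  fixes f g h :: "real \<Rightarrow> real ^ 'm"
  assumes f: "unpredictable \<theta> f" and fgh: "\<And>t. f t = g t + h t"
    and g: "\<And>t. norm (g t) \<le> H" and h: "((\<lambda>t. norm (h t)) \<longlongrightarrow> 0) at_top"
  shows "norm (f t) \<le> H"
proof -
  obtain \<mu> :: "nat \<Rightarrow> real" where \<mu>: "filterlim \<mu> at_top sequentially"
    and lim: "(\<lambda>n. f (t + \<mu> n)) \<longlonglongrightarrow> f t"
    using unpredictable_recurrence[OF f] by metis
  have "filterlim (\<lambda>n. t + \<mu> n) at_top sequentially"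
    by (rule filterlim_tendsto_add_at_top[OF tendsto_const \<mu>])
  then have "(\<lambda>n. norm (h (t + \<mu> n))) \<longlonglongrightarrow> 0"
    by (rule filterlim_compose[OF h])
  then have "(\<lambda>n. H + norm (h (t + \<mu> n))) \<longlonglongrightarrow> H + 0"
    by (intro tendsto_intros)
  moreover have "norm (f (t + \<mu> n)) \<le> H + norm (h (t + \<mu> n))" for n
    using norm_triangle_ineq[of "g (t + \<mu> n)" "h (t + \<mu> n)"] g[of "t + \<mu> n"] fgh by simp
  ultimately show ?thesis
    using LIMSEQ_le[OF tendsto_norm[OF lim]] by auto
qed

theorem lemma2p4:
  fixes \<theta> :: "int \<Rightarrow> real" and p :: nat and \<omega> H :: real
    and \<psi> \<xi> \<phi> :: "real \<Rightarrow> real ^ 'm"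
  assumes "\<omega> > 0" and "\<theta> \<in> S_seq p \<omega>"
    and "\<psi> \<in> BPC \<theta>" and "unpredictable \<theta> \<psi>"
    and "H > 0" and "(SUP t. norm (\<psi> t)) \<le> H"
    and "\<xi> \<in> BPC \<theta>" and "((\<lambda>t. norm (\<xi> t)) \<longlongrightarrow> 0) at_top"
    and "(\<exists>t\<^sub>0. norm (\<xi> t\<^sub>0) \<ge> 4 * H) \<or> (\<exists>k\<^sub>0. norm (right_limit \<xi> (\<theta> k\<^sub>0)) > 4 * H)"
    and "\<And>t. \<phi> t = \<psi> t + \<xi> t"
  shows "asymptotically_unpredictable \<theta> \<phi> \<and> \<not> unpredictable \<theta> \<phi>"
proof
  have "\<phi> = (\<lambda>t. \<psi> t + \<xi> t)"
    using assms(10) by blast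
  then have "\<phi> \<in> BPC \<theta>"
    using BPC_add[OF assms(3,7)] by simp
  then show "asymptotically_unpredictable \<theta> \<phi>"
    unfolding asymptotically_unpredictable_def using assms by blast
next
  \<comment> \<open>A real \<open>SUP\<close> dominates the values only over a set bounded above, so
    boundedness has to be established first.\<close>
  have "bounded (range \<psi>)"
    using assms(3) by (simp add: BPC_def)
  then have "bdd_above (range (\<lambda>t. norm (\<psi> t)))"
    by (auto simp: bounded_iff bdd_above_def)
  then have \<psi>_le: "norm (\<psi> t) \<le> H" for t
    using cSUP_upper[of t UNIV "\<lambda>t. norm (\<psi> t)"] assms(6) by force
  obtain t where t: "norm (\<xi> t) \<ge> 4 * H"
    using assms(9)
  proof (elim disjE exE)
    fix k assume k: "norm (right_limit \<xi> (\<theta> k)) > 4 * H"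
    \<comment> \<open>Strictness matters here: a strict lower bound on the limit passes to nearby
      values, while a non-strict one need not.\<close>
    have "\<forall>\<^sub>F t in at_right (\<theta> k). 4 * H < norm (\<xi> t)"
      by (rule order_tendstoD(1)[OF tendsto_norm[OF BPC_tendsto_right_limit[OF assms(7)]] k])
    \<comment> \<open>A witness exists because \<open>at_right\<close> is not the trivial
      filter.\<close>
    then have "\<exists>t. 4 * H < norm (\<xi> t)"
      by (rule eventually_happens'[rotated]) simp
    with that show ?thesis
      by (auto intro: less_imp_le)
  qed (rule that)
  show "\<not> unpredictable \<theta> \<phi>"
  proof
    assume "unpredictable \<theta> \<phi>"
    then have "norm (\<phi> t) \<le> H"
      by (rule unpredictable_norm_le[OF _ assms(10) \<psi>_le assms(8)])
    \<comment> \<open>Writing \<xi> as \<phi> - \<psi> leads to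
      \<open>4 * H \<le> norm (\<xi> t) \<le> 2 * H\<close>, which contradicts
      \<open>H > 0\<close>.\<close>
    moreover have "norm (\<xi> t) \<le> norm (\<phi> t) + norm (\<psi> t)"
      using norm_triangle_ineq4[of "\<phi> t" "\<psi> t"] assms(10) by simp
    ultimately show False
      using t \<psi>_le[of t] \<open>H > 0\<close> by linarith
  qed
qed

end
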